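(* Let $(\mathbf S,\mathcal A,\to)$ be a PTS and $\lambda\in(0,1]$ a discount factor. For all processes $s,t\in\mathbf S$ and every $k\in\mathbb N$, $\ell_\lambda^k(s,t)=\mathbf d_\lambda^k(s,t)$. Moreover, if $s$ and $t$ are finite, then $\ell_\lambda(s,t)=\mathbf d_\lambda(s,t)$.
   Context: A PTS is a triple $(\mathbf S,\mathcal A,\to)$ with $\mathbf S$ a countable set of processes, $\mathcal A$ a countable set of actions and $\to\subseteq\mathbf S\times\mathcal A\times\Delta(\mathbf S)$, where $\Delta(\mathbf S)$ is the set of probability distributions on $\mathbf S$ with finite support. Write $s\xrightarrow{a}\pi$ for $(s,a,\pi)\in\to$; $\mathrm{init}(s)=\{a\mid\exists\pi.\ s\xrightarrow a\pi\}$; $\mathrm{der}(s,a)=\{\pi\mid s\xrightarrow a\pi\}$; $\mathrm{supp}(\pi)=\{t\mid\pi(t)>0\}$. The depth of $s$ is $0$ if $\mathrm{init}(s)=\emptyset$, otherwise $1+\sup\{\mathrm{depth}(t)\mid a\in\mathrm{init}(s),\pi\in\mathrm{der}(s,a),t\in\mathrm{supp}(\pi)\}$. A process is finite if $\mathrm{der}(s,a)$ is finite for all $a$ and its depth is finite. Bisimulation metric: for $d:\mathbf S\times\mathbf S\to[0,1]$, the Kantorovich lifting is $\mathbf K(d)(\pi,\pi')=\min_{w}\sum_{s,t}w(s,t)d(s,t)$, the minimum over all distributions $w$ on $\mathbf S\times\mathbf S$ with left marginal $\pi$ and right marginal $\pi'$. For $\hat d$ on $\Delta(\mathbf S)$,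 the Hausdorff lifting is $\mathbf H(\hat d)(\Pi_1,\Pi_2)=\max\{\sup_{\pi_1\in\Pi_1}\inf_{\pi_2\in\Pi_2}\hat d(\pi_1,\pi_2),\sup_{\pi_2\in\Pi_2}\inf_{\pi_1\in\Pi_1}\hat d(\pi_2,\pi_1)\}$ with $\inf\emptyset=1$, $\sup\emptyset=0$. Define $\mathbf B(d)(s,t)=\sup_{a\in\mathcal A}\mathbf H(\lambda\cdot\mathbf K(d))(\mathrm{der}(s,a),\mathrm{der}(t,a))$. Then $\mathbf d_\lambda^k=\mathbf B^k(\mathbf 0)$ ($\mathbf 0$ the constant-zero function), and $\mathbf d_\lambda$ is the least fixed point of $\mathbf B$ on the complete lattice of functions $\mathbf S\times\mathbf S\to[0,1]$ ordered pointwise. Logic $\mathcal L$: state formulae $\varphi::=\top\mid\neg\varphi\mid\bigwedge_{j\in J}\varphi_j\mid\langle a\rangle\psi$ ($J\ne\emptyset$ at most countable), distribution formulae $\psi::=\bigoplus_{i\in I}r_i\varphi_i$ ($I$ finite nonempty, $r_i\in(0,1]$, $\sum r_i=1$); a distribution formula is viewed as a probability distribution over state formulae. Mimicking formulae: $\varphi_s^0=\top$; for $k\ge1$, $\varphi_s^k=\bigwedge_{(s,a,\pi)\in\to}\langle a\rangle\psi_\pi^{k-1}\wedge\bigwedge_{b\notin\mathrm{init}(s)}\neg\langle b\rangle\top$ with $\psi_\pi^k=\bigoplus_{u\in\mathrm{supp}(\pi)}\pi(u)\varphi_u^k$; for finite $s$, $\varphi_s=\varphi_s^{\mathrm{depth}(s)+1}$.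 Distance between formulae: a logical matching for $\psi_1=\bigoplus_{i\in I}r_i\varphi_i$ and $\psi_2=\bigoplus_{j\in J}r_j\varphi_j$ is a probability distribution $w$ on pairs of state formulae with marginals $\psi_1$ and $\psi_2$ ($\sum_\varphi w(\varphi_i,\varphi)=r_i$, $\sum_\varphi w(\varphi,\varphi_j)=r_j$). $D^0(\varphi_1,\varphi_2)=0$ for all state formulae; for $k\ge1$: $D^k(\top,\top)=0$; $D^k(\neg\varphi_1',\neg\varphi_2')=D^k(\varphi_1',\varphi_2')$; $D^k(\langle a\rangle\psi_1,\langle a\rangle\psi_2)=\lambda\cdot D_\Delta^{k-1}(\psi_1,\psi_2)$; $D^k(\bigwedge_{j\in J}\varphi_j,\bigwedge_{i\in I}\varphi_i)=\max\{\sup_{j\in J}\inf_{i\in I}D^k(\varphi_j,\varphi_i),\sup_{i\in I}\inf_{j\in J}D^k(\varphi_j,\varphi_i)\}$; $D^k(\varphi_1,\varphi_2)=1$ in all other cases. For every $k$, $D_\Delta^k(\psi_1,\psi_2)=\min_{w}\sum_{\varphi',\varphi''}w(\varphi',\varphi'')D^k(\varphi',\varphi'')$ over logical matchings $w$. $D(\varphi,\varphi')=\lim_{k\to\infty}D^k(\varphi,\varphi')$. Logical distance: $\ell_\lambda^k(s,t)=D^k(\varphi_s^k,\varphi_t^k)$, and for finite $s,t$, $\ell_\lambda(s,t)=D(\varphi_s,\varphi_t)$. *)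

theory Defs
  imports "HOL-Probability.Probability"
begin

section \<open>Probabilistic transition systems\<close>

text \<open>
  The countable sets of processes and actions are types of class \<open>countable\<close>; a transition system
  is its set of transitions.
\<close>

type_synonym ('s, 'a) transition = "'s \<times> 'a \<times> 's pmf"

definition pts :: "('s::countable, 'a::countable) transition set \<Rightarrow> bool" where
  "pts T \<longleftrightarrow> (\<forall>(s, a, \<pi>) \<in> T. finite (set_pmf \<pi>))"

definition der :: "('s, 'a) transition set \<Rightarrow> 's \<Rightarrow> 'a \<Rightarrow> 's pmf set" where
  "der T s a = {\<pi>. (s, a, \<pi>) \<in> T}"

definition init :: "('s, 'a) transition set \<Rightarrow> 's \<Rightarrow> 'a set" where
  "init T s = {a. \<exists>\<pi>. (s, a, \<pi>) \<in> T}"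

text \<open>
  The recursive equation for the depth (lemma \<open>depth_eq\<close>) is solved in the extended naturals.
  Its solution is unique: an infinite path forces the value \<open>\<infinity>\<close> at its origin, and where there is
  no infinite path the recursion is well-founded.
\<close>

definition depth_op ::
  "('s, 'a) transition set \<Rightarrow> ('s \<Rightarrow> enat) \<Rightarrow> 's \<Rightarrow> enat" where
  "depth_op T f s = (if init T s = {} then 0
     else 1 + Sup {f t | a \<pi> t. a \<in> init T s \<and> \<pi> \<in> der T s a \<and> t \<in> set_pmf \<pi>})"

definition depth :: "('s, 'a) transition set \<Rightarrow> 's \<Rightarrow> enat" where
  "depth T = lfp (depth_op T)"

lemma depth_eq:
  "depth T s = (if init T s = {} then 0
     else 1 + Sup {depth T t | a \<pi> t. a \<in> init T s \<and> \<pi> \<in> der T s a \<and> t \<in> set_pmf \<pi>})"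
proof -
  have "depth_op T f s \<le> depth_op T g s" if "f \<le> g" for f g s
  proof -
    have "Sup {f t | a \<pi> t. a \<in> init T s \<and> \<pi> \<in> der T s a \<and> t \<in> set_pmf \<pi>}
        \<le> Sup {g t | a \<pi> t. a \<in> init T s \<and> \<pi> \<in> der T s a \<and> t \<in> set_pmf \<pi>}"
      by (rule complete_lattice_class.Sup_mono) (use that in \<open>auto simp: le_fun_def\<close>)
    then show ?thesis
      unfolding depth_op_def by (simp add: add_left_mono)
  qed
  then have "mono (depth_op T)"
    by (auto intro!: monoI simp: le_fun_def)
  then have "depth T = depth_op T (depth T)"
    unfolding depth_def by (rule lfp_unfold)
  then have "depth T s = depth_op T (depth T) s"
    by (rule fun_cong)
  then show ?thesis
    unfolding depth_op_def .
qed

definition finite_process :: "('s, 'a) transition set \<Rightarrow> 's \<Rightarrow> bool" where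
  "finite_process T s \<longleftrightarrow> (\<forall>a. finite (der T s a)) \<and> depth T s \<noteq> \<infinity>"

section \<open>Kantorovich and Hausdorff liftings\<close>

text \<open>
  Suprema and infima in the complete lattice \<open>[0,1]\<close>: for a set of numbers in \<open>[0,1]\<close> the
  added element only matters if the set is empty.
\<close>

definition sup01 :: "real set \<Rightarrow> real" where
  "sup01 X = Sup (insert 0 X)"

definition inf01 :: "real set \<Rightarrow> real" where
  "inf01 X = Inf (insert 1 X)"

definition matchings :: "'x pmf \<Rightarrow> 'x pmf \<Rightarrow> ('x \<times> 'x) pmf set" where
  "matchings p q = {w. map_pmf fst w = p \<and> map_pmf snd w = q}"

text \<open>
  For finitely supported distributions the infimum is a minimum and the expectation a finite sum;
  see lemma \<open>kantorovich_min\<close> below.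
\<close>

definition kantorovich :: "('x \<Rightarrow> 'x \<Rightarrow> real) \<Rightarrow> 'x pmf \<Rightarrow> 'x pmf \<Rightarrow> real" where
  "kantorovich d p q = (INF w\<in>matchings p q. measure_pmf.expectation w (\<lambda>(x, y). d x y))"

definition hausdorff :: "('x \<Rightarrow> 'x \<Rightarrow> real) \<Rightarrow> 'x set \<Rightarrow> 'x set \<Rightarrow> real" where
  "hausdorff d P Q = max
     (sup01 ((\<lambda>p. inf01 ((\<lambda>q. d p q) ` Q)) ` P))
     (sup01 ((\<lambda>q. inf01 ((\<lambda>p. d q p) ` P)) ` Q))"

lemma matchings_nonempty: "matchings p q \<noteq> {}"
proof -
  have "pair_pmf p q \<in> matchings p q"
    by (simp add: matchings_def map_fst_pair_pmf map_snd_pair_pmf)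
  then show ?thesis by blast
qed

lemma matching_support:
  assumes "w \<in> matchings p q"
  shows "set_pmf w \<subseteq> set_pmf p \<times> set_pmf q"
proof -
  have "set_pmf p = fst ` set_pmf w" "set_pmf q = snd ` set_pmf w"
    using assms by (auto simp: matchings_def simp flip: set_map_pmf)
  then show ?thesis by force
qed

lemma matching_sum:
  assumes "w \<in> matchings p q" "finite (set_pmf p)" "finite (set_pmf q)"
  shows "measure_pmf.expectation w (\<lambda>(x, y). d x y)
       = (\<Sum>x\<in>set_pmf p. \<Sum>y\<in>set_pmf q. pmf w (x, y) * d x y)"
proof -
  have "measure_pmf.expectation w (\<lambda>(x, y). d x y)
      = (\<Sum>z\<in>set_pmf p \<times> set_pmf q. pmf w z * (\<lambda>(x, y). d x y) z)"
    using assms matching_support[OF assms(1)]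
    by (subst integral_measure_pmf[of "set_pmf p \<times> set_pmf q"]) (auto simp: set_pmf_iff)
  then show ?thesis
    by (simp add: sum.cartesian_product case_prod_unfold)
qed

lemma fst_marginal_sum:
  assumes "set_pmf w \<subseteq> A \<times> B" "finite B"
  shows "pmf (map_pmf fst w) x = (\<Sum>y\<in>B. pmf w (x, y))"
proof -
  have "pmf (map_pmf fst w) x = measure w (fst -` {x} \<inter> set_pmf w)"
    by (simp add: pmf_map measure_Int_set_pmf)
  also have "fst -` {x} \<inter> set_pmf w = Pair x ` B \<inter> set_pmf w"
    using assms by force
  also have "measure w (Pair x ` B \<inter> set_pmf w) = (\<Sum>z\<in>Pair x ` B. pmf w z)"
    using assms by (simp add: measure_Int_set_pmf measure_measure_pmf_finite)
  also have "\<dots> = (\<Sum>y\<in>B. pmf w (x, y))"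
    by (simp add: sum.reindex inj_on_def)
  finally show ?thesis .
qed

lemma snd_marginal_sum:
  assumes "set_pmf w \<subseteq> A \<times> B" "finite A"
  shows "pmf (map_pmf snd w) y = (\<Sum>x\<in>A. pmf w (x, y))"
proof -
  have "pmf (map_pmf snd w) y = measure w (snd -` {y} \<inter> set_pmf w)"
    by (simp add: pmf_map measure_Int_set_pmf)
  also have "snd -` {y} \<inter> set_pmf w = (\<lambda>x. (x, y)) ` A \<inter> set_pmf w"
    using assms by force
  also have "measure w ((\<lambda>x. (x, y)) ` A \<inter> set_pmf w) = (\<Sum>z\<in>(\<lambda>x. (x, y)) ` A. pmf w z)"
    using assms by (simp add: measure_Int_set_pmf measure_measure_pmf_finite)
  also have "\<dots> = (\<Sum>x\<in>A. pmf w (x, y))"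
    by (simp add: sum.reindex inj_on_def)
  finally show ?thesis .
qed

lemma kantorovich_min:
  fixes d :: "'x \<Rightarrow> 'x \<Rightarrow> real"
  assumes fin: "finite (set_pmf p)" "finite (set_pmf q)"
  shows "\<exists>w\<in>matchings p q.
           kantorovich d p q = (\<Sum>x\<in>set_pmf p. \<Sum>y\<in>set_pmf q. pmf w (x, y) * d x y) \<and>
           (\<forall>w'\<in>matchings p q. (\<Sum>x\<in>set_pmf p. \<Sum>y\<in>set_pmf q. pmf w (x, y) * d x y)
              \<le> (\<Sum>x\<in>set_pmf p. \<Sum>y\<in>set_pmf q. pmf w' (x, y) * d x y))"
proof -
  let ?A = "set_pmf p" and ?B = "set_pmf q"
  define cost :: "('x \<times> 'x \<Rightarrow> real) \<Rightarrow> real"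
    where "cost f = (\<Sum>x\<in>?A. \<Sum>y\<in>?B. f (x, y) * d x y)" for f
  define box :: "('x \<times> 'x \<Rightarrow> real) set"
    where "box = PiE UNIV (\<lambda>z. if z \<in> ?A \<times> ?B then {0..1} else {0})"
  define M where "M = box \<inter> (\<Inter>x\<in>?A. {f. (\<Sum>y\<in>?B. f (x, y)) = pmf p x})
                          \<inter> (\<Inter>y\<in>?B. {f. (\<Sum>x\<in>?A. f (x, y)) = pmf q y})"
  have into: "pmf w \<in> M" if w: "w \<in> matchings p q" for w
  proof -
    note s = matching_support[OF w]
    have "pmf w z = 0" if "z \<notin> ?A \<times> ?B" for z
      using s that by (meson set_pmf_iff subsetD)
    then have "pmf w \<in> box"
      unfolding box_def by (auto simp: PiE_def Pi_def pmf_le_1)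
    moreover have "(\<Sum>y\<in>?B. pmf w (x, y)) = pmf p x" for x
      using fst_marginal_sum[OF s fin(2), of x] w by (simp add: matchings_def)
    moreover have "(\<Sum>x\<in>?A. pmf w (x, y)) = pmf q y" for y
      using snd_marginal_sum[OF s fin(1), of y] w by (simp add: matchings_def)
    ultimately show ?thesis
      unfolding M_def by blast
  qed
  have onto: "\<exists>w\<in>matchings p q. pmf w = f" if f: "f \<in> M" for f
  proof -
    have box: "f z \<in> (if z \<in> ?A \<times> ?B then {0..1} else {0})" for z
      using f unfolding M_def box_def PiE_def Pi_def by blast
    have nn: "0 \<le> f z" and out: "z \<notin> ?A \<times> ?B \<Longrightarrow> f z = 0" for z
      using box[of z] by (auto split: if_splits)
    have r: "(\<Sum>y\<in>?B. f (x, y)) = pmf p x" if "x \<in> ?A" for x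
      using f that unfolding M_def by blast
    have c: "(\<Sum>x\<in>?A. f (x, y)) = pmf q y" if "y \<in> ?B" for y
      using f that unfolding M_def by blast
    have "(\<integral>\<^sup>+ z. ennreal (f z) \<partial>count_space UNIV)
        = (\<integral>\<^sup>+ z. ennreal (f z) * indicator (?A \<times> ?B) z \<partial>count_space UNIV)"
      by (intro nn_integral_cong) (auto simp: out indicator_def)
    also have "\<dots> = (\<integral>\<^sup>+ z. ennreal (f z) \<partial>count_space (?A \<times> ?B))"
      by (simp add: nn_integral_count_space_indicator)
    also have "\<dots> = ennreal (\<Sum>z\<in>?A \<times> ?B. f z)"
      using fin nn by (simp add: nn_integral_count_space_finite sum_ennreal)
    also have "(\<Sum>z\<in>?A \<times> ?B. f z) = (\<Sum>x\<in>?A. \<Sum>y\<in>?B. f (x, y))"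
      by (simp add: sum.cartesian_product)
    also have "\<dots> = (\<Sum>x\<in>?A. pmf p x)"
      by (simp add: r)
    also have "\<dots> = 1"
      using fin by (simp add: sum_pmf_eq_1)
    finally have one: "(\<integral>\<^sup>+ z. ennreal (f z) \<partial>count_space UNIV) = 1"
      by simp
    define w where "w = embed_pmf f"
    have w: "pmf w = f"
      unfolding w_def using pmf_embed_pmf[of f] nn one by auto
    have s: "set_pmf w \<subseteq> ?A \<times> ?B"
      using out w by (metis set_pmf_iff subsetI)
    have "map_pmf fst w = p"
    proof (rule pmf_eqI)
      fix x
      show "pmf (map_pmf fst w) x = pmf p x"
      proof (cases "x \<in> ?A")
        case True
        then show ?thesis using fst_marginal_sum[OF s fin(2), of x] r w by simp
      next
        case False
        then have "(\<Sum>y\<in>?B. f (x, y)) = 0"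
          by (intro sum.neutral) (auto simp: out)
        then show ?thesis
          using False fst_marginal_sum[OF s fin(2), of x] w by (simp add: set_pmf_iff)
      qed
    qed
    moreover have "map_pmf snd w = q"
    proof (rule pmf_eqI)
      fix y
      show "pmf (map_pmf snd w) y = pmf q y"
      proof (cases "y \<in> ?B")
        case True
        then show ?thesis using snd_marginal_sum[OF s fin(1), of y] c w by simp
      next
        case False
        then have "(\<Sum>x\<in>?A. f (x, y)) = 0"
          by (intro sum.neutral) (auto simp: out)
        then show ?thesis
          using False snd_marginal_sum[OF s fin(1), of y] w by (simp add: set_pmf_iff)
      qed
    qed
    ultimately show ?thesis
      using w by (auto simp: matchings_def)
  qed
  have "compactin (product_topology (\<lambda>_. euclidean) UNIV) box"
    unfolding box_def by (subst compactin_PiE) auto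
  then have "compact box"
    by (simp add: euclidean_product_topology)
  moreover have "closed {f :: 'x \<times> 'x \<Rightarrow> real. (\<Sum>y\<in>?B. f (x, y)) = pmf p x}" for x
    by (intro closed_Collect_eq continuous_intros continuous_on_product_coordinates)
  moreover have "closed {f :: 'x \<times> 'x \<Rightarrow> real. (\<Sum>x\<in>?A. f (x, y)) = pmf q y}" for y
    by (intro closed_Collect_eq continuous_intros continuous_on_product_coordinates)
  ultimately have "compact M"
    unfolding M_def by (intro compact_Int_closed closed_INT) auto
  moreover have "M \<noteq> {}"
    using into matchings_nonempty[of p q] by blast
  moreover have "continuous_on M cost"
    unfolding cost_def
    by (intro continuous_intros continuous_on_subset[OF continuous_on_product_coordinates]) auto
  ultimately obtain f where f: "f \<in> M" "\<And>g. g \<in> M \<Longrightarrow> cost f \<le> cost g"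
    using continuous_attains_inf[of M cost] by auto
  obtain w where w: "w \<in> matchings p q" "pmf w = f"
    using onto[OF f(1)] by blast
  have le: "cost (pmf w) \<le> cost (pmf w')" if "w' \<in> matchings p q" for w'
    using f(2)[OF into[OF that]] w by simp
  have E: "measure_pmf.expectation w' (\<lambda>(x, y). d x y) = cost (pmf w')"
    if "w' \<in> matchings p q" for w'
    using matching_sum[OF that fin] by (simp add: cost_def)
  have "kantorovich d p q = (INF w\<in>matchings p q. cost (pmf w))"
    unfolding kantorovich_def by (intro INF_cong) (auto simp: E)
  also have "\<dots> = cost (pmf w)"
    using w le by (intro cInf_eq_minimum) auto
  finally show ?thesis
    using w le unfolding cost_def by blast
qed

section \<open>Bisimulation metric\<close>

definition bisim_op ::
  "real \<Rightarrow> ('s, 'a) transition set \<Rightarrow> ('s \<Rightarrow> 's \<Rightarrow> real) \<Rightarrow> 's \<Rightarrow> 's \<Rightarrow> real" where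
  "bisim_op disc T d s t =
     sup01 (range (\<lambda>a. hausdorff (\<lambda>\<pi> \<pi>'. disc * kantorovich d \<pi> \<pi>') (der T s a) (der T t a)))"

definition bisim_metric_upto ::
  "real \<Rightarrow> ('s, 'a) transition set \<Rightarrow> nat \<Rightarrow> 's \<Rightarrow> 's \<Rightarrow> real" where
  "bisim_metric_upto disc T k = (bisim_op disc T ^^ k) (\<lambda>_ _. 0)"

definition unit_valued :: "('s \<Rightarrow> 's \<Rightarrow> real) \<Rightarrow> bool" where
  "unit_valued d \<longleftrightarrow> (\<forall>s t. 0 \<le> d s t \<and> d s t \<le> 1)"

text \<open>Lemma \<open>bisim_metric_least\<close> shows that the least fixed point exists.\<close>

definition bisim_metric ::
  "real \<Rightarrow> ('s, 'a) transition set \<Rightarrow> 's \<Rightarrow> 's \<Rightarrow> real" where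
  "bisim_metric disc T = (THE d. unit_valued d \<and> bisim_op disc T d = d \<and>
     (\<forall>d'. unit_valued d' \<and> bisim_op disc T d' = d' \<longrightarrow> d \<le> d'))"

lemma sup01_bounds: "X \<subseteq> {0..1} \<Longrightarrow> 0 \<le> sup01 X \<and> sup01 X \<le> 1"
  unfolding sup01_def
  by (auto intro!: cSup_upper cSup_least bdd_aboveI[of _ 1])

lemma inf01_bounds: "X \<subseteq> {0..1} \<Longrightarrow> 0 \<le> inf01 X \<and> inf01 X \<le> 1"
  unfolding inf01_def
  by (auto intro!: cInf_lower cInf_greatest bdd_belowI[of _ 0])

lemma sup01_mono:
  assumes "\<And>x. x \<in> X \<Longrightarrow> f x \<le> g x" "g ` X \<subseteq> {0..1}"
  shows "sup01 (f ` X) \<le> sup01 (g ` X)"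
  unfolding sup01_def
proof (rule cSup_mono)
  show "bdd_above (insert 0 (g ` X))"
    using assms(2) by (auto intro!: bdd_aboveI[of _ 1])
qed (use assms in auto)

lemma inf01_mono:
  assumes "\<And>x. x \<in> X \<Longrightarrow> f x \<le> g x" "f ` X \<subseteq> {0..1}"
  shows "inf01 (f ` X) \<le> inf01 (g ` X)"
  unfolding inf01_def
proof (rule cInf_mono)
  show "bdd_below (insert 1 (f ` X))"
    using assms(2) by (auto intro!: bdd_belowI[of _ 0])
qed (use assms in auto)

lemma expectation_bounds:
  assumes "unit_valued d"
  shows "0 \<le> measure_pmf.expectation w (\<lambda>(x, y). d x y)"
    and "measure_pmf.expectation w (\<lambda>(x, y). d x y) \<le> 1"
    and "integrable w (\<lambda>(x, y). d x y)"
proof -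
  show i: "integrable w (\<lambda>(x, y). d x y)"
    using assms by (intro measure_pmf.integrable_const_bound[where B = 1]) (auto simp: unit_valued_def)
  show "0 \<le> measure_pmf.expectation w (\<lambda>(x, y). d x y)"
    using assms by (intro integral_nonneg_AE) (auto simp: unit_valued_def)
  show "measure_pmf.expectation w (\<lambda>(x, y). d x y) \<le> 1"
    using assms i by (intro measure_pmf.integral_le_const) (auto simp: unit_valued_def)
qed

lemma kantorovich_bounds:
  assumes "unit_valued d"
  shows "0 \<le> kantorovich d p q" "kantorovich d p q \<le> 1"
proof -
  show "0 \<le> kantorovich d p q"
    unfolding kantorovich_def
    by (intro cINF_greatest matchings_nonempty expectation_bounds assms)
  obtain w where w: "w \<in> matchings p q"
    using matchings_nonempty[of p q] by blast
  have "kantorovich d p q \<le> measure_pmf.expectation w (\<lambda>(x, y). d x y)"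
    unfolding kantorovich_def
    by (intro cINF_lower w bdd_belowI2[of _ 0] expectation_bounds assms)
  then show "kantorovich d p q \<le> 1"
    using expectation_bounds(2)[OF assms, of w] by linarith
qed

lemma kantorovich_mono:
  assumes "unit_valued d" "unit_valued d'" "d \<le> d'"
  shows "kantorovich d p q \<le> kantorovich d' p q"
  unfolding kantorovich_def
proof (rule cINF_mono)
  show "bdd_below ((\<lambda>w. measure_pmf.expectation w (\<lambda>(x, y). d x y)) ` matchings p q)"
    by (intro bdd_belowI2[of _ 0] expectation_bounds assms)
  fix w assume "w \<in> matchings p q"
  moreover have "measure_pmf.expectation w (\<lambda>(x, y). d x y)
      \<le> measure_pmf.expectation w (\<lambda>(x, y). d' x y)"
    using assms by (intro integral_mono expectation_bounds) (auto simp: le_fun_def)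
  ultimately show "\<exists>v\<in>matchings p q. measure_pmf.expectation v (\<lambda>(x, y). d x y)
      \<le> measure_pmf.expectation w (\<lambda>(x, y). d' x y)"
    by blast
qed (rule matchings_nonempty)

lemma hausdorff_bounds:
  assumes "\<And>p q. 0 \<le> e p q \<and> e p q \<le> 1"
  shows "0 \<le> hausdorff e P Q \<and> hausdorff e P Q \<le> 1"
proof -
  have "0 \<le> inf01 (e p ` X) \<and> inf01 (e p ` X) \<le> 1" for p X
    using assms by (intro inf01_bounds) auto
  then have "0 \<le> sup01 ((\<lambda>p. inf01 (e p ` X)) ` Y) \<and> sup01 ((\<lambda>p. inf01 (e p ` X)) ` Y) \<le> 1"
    for X Y
    by (intro sup01_bounds) auto
  then show ?thesis
    unfolding hausdorff_def by (simp add: le_max_iff_disj)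
qed

lemma hausdorff_mono:
  assumes "\<And>p q. 0 \<le> e p q \<and> e p q \<le> 1" "\<And>p q. 0 \<le> e' p q \<and> e' p q \<le> 1"
    and "\<And>p q. e p q \<le> e' p q"
  shows "hausdorff e P Q \<le> hausdorff e' P Q"
proof -
  have "inf01 (e p ` X) \<le> inf01 (e' p ` X)" for p X
    using assms by (intro inf01_mono) auto
  moreover have "0 \<le> inf01 (e' p ` X) \<and> inf01 (e' p ` X) \<le> 1" for p X
    using assms by (intro inf01_bounds) auto
  ultimately have "sup01 ((\<lambda>p. inf01 (e p ` X)) ` Y) \<le> sup01 ((\<lambda>p. inf01 (e' p ` X)) ` Y)"
    for X Y
    by (intro sup01_mono) auto
  then show ?thesis
    unfolding hausdorff_def by (intro max.mono)
qed

lemma scaled_kantorovich_bounds: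
  assumes "0 < disc" "disc \<le> 1" "unit_valued d"
  shows "0 \<le> disc * kantorovich d p q \<and> disc * kantorovich d p q \<le> 1"
  using assms kantorovich_bounds[OF assms(3), of p q] by (simp add: mult_le_one)

lemma bisim_op_unit_valued:
  assumes "0 < disc" "disc \<le> 1" "unit_valued d"
  shows "unit_valued (bisim_op disc T d)"
proof -
  have "range (\<lambda>a. hausdorff (\<lambda>\<pi> \<pi>'. disc * kantorovich d \<pi> \<pi>') (der T s a) (der T t a)) \<subseteq> {0..1}"
    for s t
    using hausdorff_bounds[of "\<lambda>\<pi> \<pi>'. disc * kantorovich d \<pi> \<pi>'"]
      scaled_kantorovich_bounds[OF assms] by auto
  from sup01_bounds[OF this] show ?thesis
    unfolding unit_valued_def bisim_op_def by blast
qed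

lemma bisim_op_mono:
  assumes "0 < disc" "disc \<le> 1" "unit_valued d" "unit_valued d'" "d \<le> d'"
  shows "bisim_op disc T d \<le> bisim_op disc T d'"
proof (intro le_funI)
  fix s t
  show "bisim_op disc T d s t \<le> bisim_op disc T d' s t"
    unfolding bisim_op_def
  proof (rule sup01_mono)
    fix a
    show "hausdorff (\<lambda>\<pi> \<pi>'. disc * kantorovich d \<pi> \<pi>') (der T s a) (der T t a)
        \<le> hausdorff (\<lambda>\<pi> \<pi>'. disc * kantorovich d' \<pi> \<pi>') (der T s a) (der T t a)"
      using assms
      by (intro hausdorff_mono scaled_kantorovich_bounds mult_left_mono kantorovich_mono) auto
  next
    show "range (\<lambda>a. hausdorff (\<lambda>\<pi> \<pi>'. disc * kantorovich d' \<pi> \<pi>') (der T s a) (der T t a)) \<subseteq> {0..1}"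
      using hausdorff_bounds[of "\<lambda>\<pi> \<pi>'. disc * kantorovich d' \<pi> \<pi>'"]
        scaled_kantorovich_bounds[OF assms(1,2,4)] by auto
  qed
qed

lemma bisim_metric_least:
  assumes "0 < disc" "disc \<le> 1"
  shows "unit_valued (bisim_metric disc T)"
    and "bisim_op disc T (bisim_metric disc T) = bisim_metric disc T"
    and "unit_valued d \<Longrightarrow> bisim_op disc T d = d \<Longrightarrow> bisim_metric disc T \<le> d"
proof -
  let ?B = "bisim_op disc T"
  define P where "P = {d. unit_valued d \<and> ?B d \<le> d}"
  define m where "m s t = (INF d\<in>P. d s t)" for s t
  have one: "(\<lambda>_ _. 1) \<in> P"
    using bisim_op_unit_valued[OF assms, of "\<lambda>_ _. 1" T]
    by (auto simp: P_def unit_valued_def le_fun_def)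
  then have ne: "P \<noteq> {}" by blast
  have low: "m \<le> d" if "d \<in> P" for d
    unfolding m_def using that
    by (auto intro!: le_funI cINF_lower bdd_belowI2[of _ 0] simp: P_def unit_valued_def)
  have great: "d \<le> m" if "\<And>e. e \<in> P \<Longrightarrow> d \<le> e" for d
    unfolding m_def using that ne by (auto intro!: le_funI cINF_greatest dest: le_funD)
  have "(\<lambda>_ _. 0) \<le> m"
    by (rule great) (auto simp: P_def unit_valued_def le_fun_def)
  moreover have "m \<le> (\<lambda>_ _. 1)"
    by (rule low[OF one])
  ultimately have um: "unit_valued m"
    by (auto simp: unit_valued_def le_fun_def)
  have "?B m \<le> m"
  proof (rule great)
    fix e assume e: "e \<in> P"
    then have "?B m \<le> ?B e"
      by (intro bisim_op_mono assms um low) (auto simp: P_def)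
    then show "?B m \<le> e"
      using e by (auto simp: P_def intro: order_trans)
  qed
  moreover from this have "?B m \<in> P"
    unfolding P_def using bisim_op_unit_valued[OF assms um] bisim_op_mono[OF assms _ um] by blast
  ultimately have fix_m: "?B m = m"
    using low by (blast intro: antisym)
  have least: "m \<le> d" if "unit_valued d" "?B d = d" for d
    using that by (intro low) (auto simp: P_def)
  have "bisim_metric disc T = m"
    unfolding bisim_metric_def
    using um fix_m least by (intro the_equality) (auto intro: antisym)
  then show "unit_valued (bisim_metric disc T)" "?B (bisim_metric disc T) = bisim_metric disc T"
    and "unit_valued d \<Longrightarrow> ?B d = d \<Longrightarrow> bisim_metric disc T \<le> d"
    using um fix_m least by auto
qed

section \<open>The logic and the distance between formulae\<close>

text \<open>
  \<open>Conj J \<phi>\<close> is the conjunction of the family \<open>\<phi>\<close> over the index set \<open>J\<close>; the values of \<open>\<phi>\<close> outside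
  \<open>J\<close> are irrelevant. A distribution formula is the probability distribution over state formulae that
  it denotes. The type contains more than the logic, which is carved out by \<open>in_logic\<close>: the set of
  transitions leaving a process can be uncountable, and then its mimicking formulae, to which the
  distance applies all the same, are uncountable conjunctions.
\<close>

datatype ('i, 'a) sform =
    Top
  | Neg "('i, 'a) sform"
  | Conj "'i set" "'i \<Rightarrow> ('i, 'a) sform"
  | Dia 'a "('i, 'a) sform pmf"

inductive in_logic :: "('i, 'a) sform \<Rightarrow> bool" where
  "in_logic Top"
| "in_logic \<phi> \<Longrightarrow> in_logic (Neg \<phi>)"
| "\<lbrakk>J \<noteq> {}; countable J; \<And>j. j \<in> J \<Longrightarrow> in_logic (\<phi> j)\<rbrakk> \<Longrightarrow> in_logic (Conj J \<phi>)"
| "\<lbrakk>finite (set_pmf \<psi>); \<And>\<phi>. \<phi> \<in> set_pmf \<psi> \<Longrightarrow> in_logic \<phi>\<rbrakk> \<Longrightarrow> in_logic (Dia a \<psi>)"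

text \<open>
  One level of the distance, relative to a distance \<open>D\<close> on distribution formulae. The resulting
  equations for the distances of all levels are collected in lemma \<open>form_dist_upto_eqs\<close>.
\<close>

primrec form_dist_step ::
  "real \<Rightarrow> (('i, 'a) sform pmf \<Rightarrow> ('i, 'a) sform pmf \<Rightarrow> real)
     \<Rightarrow> ('i, 'a) sform \<Rightarrow> ('i, 'a) sform \<Rightarrow> real" where
  "form_dist_step disc D Top = (\<lambda>\<xi>. case \<xi> of Top \<Rightarrow> 0 | _ \<Rightarrow> 1)"
| "form_dist_step disc D (Neg \<phi>) = (\<lambda>\<xi>. case \<xi> of Neg \<phi>' \<Rightarrow> form_dist_step disc D \<phi> \<phi>' | _ \<Rightarrow> 1)"
| "form_dist_step disc D (Conj J \<phi>) = (\<lambda>\<xi>. case \<xi> of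
     Conj I \<phi>' \<Rightarrow> max
       (sup01 ((\<lambda>j. inf01 ((\<lambda>i. form_dist_step disc D (\<phi> j) (\<phi>' i)) ` I)) ` J))
       (sup01 ((\<lambda>i. inf01 ((\<lambda>j. form_dist_step disc D (\<phi> j) (\<phi>' i)) ` J)) ` I))
   | _ \<Rightarrow> 1)"
| "form_dist_step disc D (Dia a \<psi>) = (\<lambda>\<xi>. case \<xi> of
     Dia b \<psi>' \<Rightarrow> (if a = b then disc * D \<psi> \<psi>' else 1)
   | _ \<Rightarrow> 1)"

primrec form_dist_upto ::
  "real \<Rightarrow> nat \<Rightarrow> ('i, 'a) sform \<Rightarrow> ('i, 'a) sform \<Rightarrow> real" where
  "form_dist_upto disc 0 = (\<lambda>_ _. 0)"
| "form_dist_upto disc (Suc k) = form_dist_step disc (kantorovich (form_dist_upto disc k))"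

definition dist_form_dist_upto ::
  "real \<Rightarrow> nat \<Rightarrow> ('i, 'a) sform pmf \<Rightarrow> ('i, 'a) sform pmf \<Rightarrow> real" where
  "dist_form_dist_upto disc k = kantorovich (form_dist_upto disc k)"

lemma form_dist_upto_eqs:
  fixes \<phi> \<phi>' :: "('i, 'a) sform" and F G :: "'i \<Rightarrow> ('i, 'a) sform"
  shows "form_dist_upto disc 0 \<phi> \<phi>' = 0"
    and "form_dist_upto disc (Suc k) (Top :: ('i, 'a) sform) Top = 0"
    and "form_dist_upto disc (Suc k) (Neg \<phi>) (Neg \<phi>') = form_dist_upto disc (Suc k) \<phi> \<phi>'"
    and "form_dist_upto disc (Suc k) (Dia a \<psi>) (Dia a \<psi>') = disc * dist_form_dist_upto disc k \<psi> \<psi>'"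
    and "form_dist_upto disc (Suc k) (Conj J F) (Conj I G) = max
           (sup01 ((\<lambda>j. inf01 ((\<lambda>i. form_dist_upto disc (Suc k) (F j) (G i)) ` I)) ` J))
           (sup01 ((\<lambda>i. inf01 ((\<lambda>j. form_dist_upto disc (Suc k) (F j) (G i)) ` J)) ` I))"
    and "\<lbrakk>\<not> (\<phi> = Top \<and> \<phi>' = Top);
          \<nexists>\<xi> \<xi>'. \<phi> = Neg \<xi> \<and> \<phi>' = Neg \<xi>';
          \<nexists>a \<psi> \<psi>'. \<phi> = Dia a \<psi> \<and> \<phi>' = Dia a \<psi>';
          \<nexists>J F I G. \<phi> = Conj J F \<and> \<phi>' = Conj I G\<rbrakk>
         \<Longrightarrow> form_dist_upto disc (Suc k) \<phi> \<phi>' = 1"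
  by (simp_all add: dist_form_dist_upto_def) (cases \<phi>; cases \<phi>'; simp)

definition form_dist :: "real \<Rightarrow> ('i, 'a) sform \<Rightarrow> ('i, 'a) sform \<Rightarrow> real" where
  "form_dist disc \<phi> \<phi>' = lim (\<lambda>k. form_dist_upto disc k \<phi> \<phi>')"

section \<open>Mimicking formulae and the logical distance\<close>

text \<open>
  The conjunction is a single one, with one conjunct for each transition of \<open>s\<close> and one for each
  action that \<open>s\<close> cannot perform. The distribution formula \<open>\<top>\<close> is the point mass at the state
  formula \<open>\<top>\<close>.
\<close>

primrec mimic ::
  "('s, 'a) transition set \<Rightarrow> nat \<Rightarrow> 's \<Rightarrow> (('s, 'a) transition + 'a, 'a) sform" where
  "mimic T 0 = (\<lambda>s. Top)"
| "mimic T (Suc k) = (\<lambda>s.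
     Conj (Inl ` {(s', a, \<pi>) \<in> T. s' = s} \<union> Inr ` {b. b \<notin> init T s})
       (\<lambda>j. case j of
          Inl (s', a, \<pi>) \<Rightarrow> Dia a (map_pmf (mimic T k) \<pi>)
        | Inr b \<Rightarrow> Neg (Dia b (return_pmf Top))))"

definition mimic_full ::
  "('s, 'a) transition set \<Rightarrow> 's \<Rightarrow> (('s, 'a) transition + 'a, 'a) sform" where
  "mimic_full T s = mimic T (the_enat (depth T s) + 1) s"

lemma mimic_in_logic:
  fixes T :: "('s::countable, 'a::countable) transition set"
  assumes "pts T" "countable T"
  shows "in_logic (mimic T k s)"
proof (induction k arbitrary: s)
  case 0
  show ?case by (simp add: in_logic.intros)
next
  case (Suc k)
  have "{(s', a, \<pi>) \<in> T. s' = s} \<noteq> {} \<or> {b. b \<notin> init T s} \<noteq> {}"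
    by (auto simp: init_def)
  moreover have "countable {(s', a, \<pi>) \<in> T. s' = s}"
    using assms(2) by (rule countable_subset[rotated]) auto
  moreover have "in_logic (Dia a (map_pmf (mimic T k) \<pi>))" if "(s, a, \<pi>) \<in> T" for a \<pi>
    using that assms(1) Suc by (intro in_logic.intros) (auto simp: pts_def)
  moreover have "in_logic (Neg (Dia b (return_pmf Top)))" for b
    by (intro in_logic.intros) (auto intro: in_logic.intros)
  ultimately show ?case
    unfolding mimic.simps
    by (intro in_logic.intros(3)) (auto simp del: split_paired_Ex)
qed

definition logical_dist_upto ::
  "real \<Rightarrow> ('s, 'a) transition set \<Rightarrow> nat \<Rightarrow> 's \<Rightarrow> 's \<Rightarrow> real" where
  "logical_dist_upto disc T k s t = form_dist_upto disc k (mimic T k s) (mimic T k t)"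

definition logical_dist ::
  "real \<Rightarrow> ('s, 'a) transition set \<Rightarrow> 's \<Rightarrow> 's \<Rightarrow> real" where
  "logical_dist disc T s t = form_dist disc (mimic_full T s) (mimic_full T t)"

end

theory Submission
  imports Defs
begin

text \<open>
  The matchings of two image distributions are exactly the images of the matchings, so the
  Kantorovich distance of the distribution formulae of two distributions is that of the
  distributions themselves, computed with the distance of the mimicking formulae. Induction on \<open>k\<close>
  then identifies \<open>D\<^sup>k\<close> of two mimicking formulae with \<open>d\<^sup>k\<close> of the processes. For finite processes
  the two formulae may be unrolled to different levels, so the induction is done for formulae of
  arbitrary levels each of which is at least \<open>k\<close> or exceeds the depth of its process. Finally, every
  fixed point of the functional agrees with its \<open>k\<close>-th iterate on processes of depth less than \<open>k\<close>.
\<close>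

section \<open>The Kantorovich lifting\<close>

text \<open>A matching \<open>w\<close> of the images lifts by gluing: draw \<open>(x, y)\<close>
  from \<open>w\<close>, then independently draw from \<open>p\<close> conditioned on the fibre of
  \<open>f\<close> over \<open>x\<close> and from \<open>q\<close> conditioned on the fibre of
  \<open>g\<close> over \<open>y\<close>.\<close>

lemma matchings_map_pmf:
  "matchings (map_pmf f p) (map_pmf g q) = map_pmf (map_prod f g) ` matchings p q"
proof (intro equalityI subsetI)
  fix w assume "w \<in> matchings (map_pmf f p) (map_pmf g q)"
  then have w: "map_pmf fst w = map_pmf f p" "map_pmf snd w = map_pmf g q"
    by (auto simp: matchings_def)
  define P where "P x = cond_pmf p {u. f u = x}" for x
  define Q where "Q y = cond_pmf q {v. g v = y}" for y
  define v where "v = bind_pmf w (\<lambda>(x, y). pair_pmf (P x) (Q y))"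
  \<comment> \<open>Conditioning is meaningful only on events that meet the support; for pairs in
    the support of \<open>w\<close> both fibres do.\<close>
  have sw: "set_pmf p \<inter> {u. f u = x} \<noteq> {}" "set_pmf q \<inter> {v. g v = y} \<noteq> {}" if "(x, y) \<in> set_pmf w" for x y
  proof -
    have "fst ` set_pmf w = f ` set_pmf p" "snd ` set_pmf w = g ` set_pmf q"
      using w by (metis set_map_pmf)+
    then have "x \<in> f ` set_pmf p" "y \<in> g ` set_pmf q"
      using that by force+
    then show "set_pmf p \<inter> {u. f u = x} \<noteq> {}" "set_pmf q \<inter> {v. g v = y} \<noteq> {}"
      by auto
  qed
  \<comment> \<open>Total probability: averaging the conditional laws over the law of the image
    gives back \<open>p\<close>.\<close>
  have cancel_p: "bind_pmf (map_pmf f p) P = p"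
    unfolding P_def by (rule bind_cond_pmf_cancel) (auto simp: vimage_def)
  have cancel_q: "bind_pmf (map_pmf g q) Q = q"
    unfolding Q_def by (rule bind_cond_pmf_cancel) (auto simp: vimage_def)
  have "map_pmf fst v = bind_pmf w (\<lambda>z. P (fst z))"
    unfolding v_def by (simp add: map_bind_pmf case_prod_unfold map_fst_pair_pmf)
  also have "\<dots> = p"
    by (metis bind_map_pmf cancel_p w(1))
  finally have "map_pmf fst v = p" .
  moreover have "map_pmf snd v = bind_pmf w (\<lambda>z. Q (snd z))"
    unfolding v_def by (simp add: map_bind_pmf case_prod_unfold map_snd_pair_pmf)
  then have "map_pmf snd v = q"
    by (metis bind_map_pmf cancel_q w(2))
  moreover have "map_pmf (map_prod f g) v = w"
  proof -
    have "map_pmf (map_prod f g) (pair_pmf (P x) (Q y)) = return_pmf (x, y)"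
      if "(x, y) \<in> set_pmf w" for x y
    proof -
      have "map_pmf (map_prod f g) (pair_pmf (P x) (Q y))
          = map_pmf (\<lambda>_. (x, y)) (pair_pmf (P x) (Q y))"
        using sw[OF that] by (intro map_pmf_cong) (auto simp: P_def Q_def)
      then show ?thesis by simp
    qed
    then have "map_pmf (map_prod f g) v = bind_pmf w return_pmf"
      unfolding v_def map_bind_pmf by (intro bind_pmf_cong) auto
    then show ?thesis by (simp add: bind_return_pmf')
  qed
  ultimately show "w \<in> map_pmf (map_prod f g) ` matchings p q"
    by (auto simp: matchings_def)
qed (auto simp: matchings_def pmf.map_comp)

lemma kantorovich_map_pmf:
  "kantorovich d (map_pmf f p) (map_pmf g q) = kantorovich (\<lambda>x y. d (f x) (g y)) p q"
  unfolding kantorovich_def matchings_map_pmf image_image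
  by (simp add: case_prod_unfold)

text \<open>Every matching is supported in the product of the two supports, so inductive hypotheses
  about supported states suffice.\<close>

lemma kantorovich_cong:
  assumes "\<And>x y. x \<in> set_pmf p \<Longrightarrow> y \<in> set_pmf q \<Longrightarrow> d x y = d' x y"
  shows "kantorovich d p q = kantorovich d' p q"
  unfolding kantorovich_def
proof (rule INF_cong)
  fix w assume "w \<in> matchings p q"
  from matching_support[OF this] show "measure_pmf.expectation w (\<lambda>(x, y). d x y)
      = measure_pmf.expectation w (\<lambda>(x, y). d' x y)"
    using assms by (intro integral_cong_AE) (auto simp: AE_measure_pmf_iff)
qed simp

lemma matchings_swap: "matchings q p = map_pmf prod.swap ` matchings p q"
proof (intro equalityI subsetI)
  fix w assume "w \<in> matchings q p"
  then have "map_pmf prod.swap w \<in> matchings p q" "w = map_pmf prod.swap (map_pmf prod.swap w)"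
    by (auto simp: matchings_def pmf.map_comp o_def)
  then show "w \<in> map_pmf prod.swap ` matchings p q" by blast
qed (auto simp: matchings_def pmf.map_comp o_def)

lemma kantorovich_sym: "kantorovich d q p = kantorovich (\<lambda>x y. d y x) p q"
  unfolding kantorovich_def matchings_swap[of q p] image_image
  by (simp add: case_prod_unfold)

text \<open>Point masses are images of the one-point distribution under constant maps, and a
  constant cost has the same expectation under every matching.\<close>

lemma kantorovich_return_pmf: "kantorovich d (return_pmf x) (return_pmf y) = d x y"
  using kantorovich_map_pmf[of d "\<lambda>_. x" "return_pmf ()" "\<lambda>_. y" "return_pmf ()"]
  by (simp add: kantorovich_def case_prod_unfold matchings_nonempty)

section \<open>The bisimulation metric\<close>

lemma sup01_le_iff:
  assumes "X \<subseteq> {0..1}"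
  shows "sup01 X \<le> c \<longleftrightarrow> 0 \<le> c \<and> (\<forall>x\<in>X. x \<le> c)"
proof -
  have "bdd_above (insert 0 X)"
    using assms by (auto intro!: bdd_aboveI[of _ 1])
  then show ?thesis
    unfolding sup01_def by (subst cSup_le_iff) auto
qed

lemma inf01_cong: "insert 1 X = insert 1 Y \<Longrightarrow> inf01 X = inf01 Y"
  by (simp add: inf01_def)

lemma bisim_metric_upto_Suc:
  "bisim_metric_upto disc T (Suc k) = bisim_op disc T (bisim_metric_upto disc T k)"
  by (simp add: bisim_metric_upto_def)

lemma unit_valued_bisim_metric_upto:
  assumes "0 < disc" "disc \<le> 1"
  shows "unit_valued (bisim_metric_upto disc T k)"
proof (induction k)
  case 0
  show ?case by (simp add: bisim_metric_upto_def unit_valued_def)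
next
  case (Suc k)
  then show ?case by (simp add: bisim_metric_upto_Suc bisim_op_unit_valued assms)
qed

lemma hausdorff_sym: "hausdorff e P Q = hausdorff e Q P"
  by (simp add: hausdorff_def max.commute)

lemma bisim_metric_upto_sym: "bisim_metric_upto disc T k s t = bisim_metric_upto disc T k t s"
proof (cases k)
  case 0
  then show ?thesis by (simp add: bisim_metric_upto_def)
next
  case (Suc k)
  then show ?thesis by (simp add: bisim_metric_upto_Suc bisim_op_def hausdorff_sym)
qed

lemma hausdorff_cong:
  assumes "\<And>p q. p \<in> P \<Longrightarrow> q \<in> Q \<Longrightarrow> e p q = e' p q" "\<And>p q. p \<in> P \<Longrightarrow> q \<in> Q \<Longrightarrow> e q p = e' q p"
  shows "hausdorff e P Q = hausdorff e' P Q"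
  using assms by (simp add: hausdorff_def cong: image_cong)

lemma depth_derivative_less:
  assumes "\<pi> \<in> der T s a" "u \<in> set_pmf \<pi>" "depth T s < enat (Suc n)"
  shows "depth T u < enat n"
proof -
  let ?X = "{depth T t | a \<pi> t. a \<in> init T s \<and> \<pi> \<in> der T s a \<and> t \<in> set_pmf \<pi>}"
  have "a \<in> init T s"
    using assms(1) by (auto simp: der_def init_def)
  then have "depth T u \<le> Sup ?X" and eq: "depth T s = 1 + Sup ?X"
    using assms(1,2) depth_eq[of T s] by (auto intro!: Sup_upper)
  moreover have "Sup ?X < enat n"
    using assms(3) unfolding eq by (cases "Sup ?X") (auto simp: one_enat_def)
  ultimately show ?thesis by simp
qed

text \<open>One unfolding of \<open>bisim_op\<close> consults its argument only at derivatives,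
  where the depth bound drops by one. The bounds are strict, so the case \<open>k = 0\<close> is
  vacuous.\<close>

lemma bisim_metric_upto_eq_fixpoint:
  assumes "bisim_op disc T d = d" "depth T s < enat k" "depth T t < enat k"
  shows "bisim_metric_upto disc T k s t = d s t"
  using assms(2,3)
proof (induction k arbitrary: s t)
  case 0
  then show ?case by (simp add: zero_enat_def[symmetric])
next
  case (Suc k)
  have "hausdorff (\<lambda>\<pi> \<pi>'. disc * kantorovich (bisim_metric_upto disc T k) \<pi> \<pi>') (der T s a) (der T t a)
      = hausdorff (\<lambda>\<pi> \<pi>'. disc * kantorovich d \<pi> \<pi>') (der T s a) (der T t a)" for a
    using Suc.prems
    by (intro hausdorff_cong arg_cong[where f = "(*) disc"] kantorovich_cong Suc.IH)
      (auto intro: depth_derivative_less)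
  then have "bisim_metric_upto disc T (Suc k) s t = bisim_op disc T d s t"
    by (simp add: bisim_metric_upto_Suc bisim_op_def)
  then show ?case
    by (simp add: assms(1))
qed

section \<open>Distances of mimicking formulae\<close>

text \<open>Transition conjuncts with equal labels reproduce the Hausdorff distance, and all other
  pairs involving a transition conjunct have distance 1. A negated conjunct contributes 1 exactly
  when the other process enables its action, which the convention for the empty infimum already
  charges in \<open>bisim_op\<close>.\<close>

lemma form_dist_upto_mimic_Suc:
  fixes d :: "'s \<Rightarrow> 's \<Rightarrow> real" and T :: "('s, 'a) transition set"
  assumes disc: "0 < disc" "disc \<le> 1"
    and d: "unit_valued d" "\<And>u v. d u v = d v u"
    and IH: "\<And>a \<pi> \<pi>' u v. \<pi> \<in> der T s a \<Longrightarrow> \<pi>' \<in> der T t a \<Longrightarrow> u \<in> set_pmf \<pi> \<Longrightarrow> v \<in> set_pmf \<pi>' \<Longrightarrow>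
      form_dist_upto disc k (mimic T m u) (mimic T n v) = d u v"
  shows "form_dist_upto disc (Suc k) (mimic T (Suc m) s) (mimic T (Suc n) t) = bisim_op disc T d s t"
proof -
  define e where "e \<pi> \<pi>' = disc * kantorovich d \<pi> \<pi>'" for \<pi> \<pi>'
  define J where "J s = Inl ` {(s', a, \<pi>) \<in> T. s' = s} \<union> Inr ` {b. b \<notin> init T s}" for s
  define F where "F m j = (case j of
          Inl (s', a, \<pi>) \<Rightarrow> Dia a (map_pmf (mimic T m) \<pi>)
        | Inr b \<Rightarrow> Neg (Dia b (return_pmf Top)))"
    for m and j :: "('s, 'a) transition + 'a"
  define D where "D j i = form_dist_upto disc (Suc k) (F m j) (F n i)" for j i
  have mimic: "mimic T (Suc m) s = Conj (J s) (F m)" for m s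
    by (simp add: J_def F_def fun_eq_iff)
  have e01: "0 \<le> e \<pi> \<pi>' \<and> e \<pi> \<pi>' \<le> 1" for \<pi> \<pi>'
    unfolding e_def by (rule scaled_kantorovich_bounds[OF disc d(1)])
  \<comment> \<open>The distance of conjunctions keeps the argument order in both halves, whereas
    \<open>hausdorff\<close> swaps it in the second; symmetry reconciles the two.\<close>
  have e_sym: "e \<pi> \<pi>' = e \<pi>' \<pi>" for \<pi> \<pi>'
    unfolding e_def by (subst kantorovich_sym) (simp add: d(2)[symmetric])
  have top0: "form_dist_upto disc k Top Top = 0"
    by (cases k) simp_all
  have DII: "D (Inl (s, a, \<pi>)) (Inl (t, b, \<pi>')) = (if a = b then e \<pi> \<pi>' else 1)"
    if "\<pi> \<in> der T s a" "\<pi>' \<in> der T t b" for a b \<pi> \<pi>'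
    using that by (auto simp: D_def F_def e_def kantorovich_map_pmf intro!: kantorovich_cong IH)
  have DRR: "D (Inr a) (Inr b) = (if a = b then 0 else 1)" for a b
    by (simp add: D_def F_def kantorovich_return_pmf top0)
  have DIR: "D (Inl x) (Inr b) = 1" "D (Inr b) (Inl x) = 1" for x b
    by (cases x; simp add: D_def F_def)+
  have InlI: "Inl (s, a, \<pi>) \<in> J s" if "\<pi> \<in> der T s a" for s a \<pi>
    using that by (auto simp: J_def der_def)
  have InrI: "Inr b \<in> J s" if "b \<notin> init T s" for s b
    using that by (auto simp: J_def)
  have J_cases: "(\<exists>a \<pi>. j = Inl (s, a, \<pi>) \<and> \<pi> \<in> der T s a) \<or> (\<exists>b. j = Inr b \<and> b \<notin> init T s)"
    if "j \<in> J s" for j s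
    using that by (auto simp: J_def der_def)
  have ball_J: "(\<forall>j\<in>J s. P j) \<longleftrightarrow>
      (\<forall>a. \<forall>\<pi>\<in>der T s a. P (Inl (s, a, \<pi>))) \<and> (\<forall>b. b \<notin> init T s \<longrightarrow> P (Inr b))" for P s
    using InlI InrI J_cases by blast
  have left_Inl: "inf01 (D (Inl (s, a, \<pi>)) ` J t) = inf01 (e \<pi> ` der T t a)"
    if \<pi>: "\<pi> \<in> der T s a" for a \<pi>
  proof (intro inf01_cong equalityI)
    show "insert 1 (D (Inl (s, a, \<pi>)) ` J t) \<subseteq> insert 1 (e \<pi> ` der T t a)"
      using \<pi> by (auto dest!: J_cases simp: DII DIR)
    show "insert 1 (e \<pi> ` der T t a) \<subseteq> insert 1 (D (Inl (s, a, \<pi>)) ` J t)"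
      using \<pi> by (auto intro!: rev_image_eqI[OF InlI] simp: DII)
  qed
  have right_Inl: "inf01 ((\<lambda>j. D j (Inl (t, a, \<pi>))) ` J s) = inf01 (e \<pi> ` der T s a)"
    if \<pi>: "\<pi> \<in> der T t a" for a \<pi>
  proof (intro inf01_cong equalityI)
    show "insert 1 ((\<lambda>j. D j (Inl (t, a, \<pi>))) ` J s) \<subseteq> insert 1 (e \<pi> ` der T s a)"
      using \<pi> by (auto dest!: J_cases simp: DII DIR e_sym[of _ \<pi>])
    show "insert 1 (e \<pi> ` der T s a) \<subseteq> insert 1 ((\<lambda>j. D j (Inl (t, a, \<pi>))) ` J s)"
      using \<pi> by (auto intro!: rev_image_eqI[OF InlI] simp: DII e_sym[of \<pi>])
  qed
  \<comment> \<open>The only possible partner at distance 0 is the negated conjunct for the same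
    \<open>b\<close>, present iff \<open>t\<close> refuses \<open>b\<close>.\<close>
  have left_Inr: "inf01 (D (Inr b) ` J t) = (if b \<in> init T t then 1 else 0)" for b
  proof -
    have "insert 1 (D (Inr b) ` J t) = (if b \<in> init T t then {1} else {0, 1})"
      by (auto dest!: J_cases simp: DRR DIR intro!: rev_image_eqI[OF InrI[of b]])
    then show ?thesis by (simp add: inf01_def cInf_eq_Min)
  qed
  have right_Inr: "inf01 ((\<lambda>j. D j (Inr b)) ` J s) = (if b \<in> init T s then 1 else 0)" for b
  proof -
    have "insert 1 ((\<lambda>j. D j (Inr b)) ` J s) = (if b \<in> init T s then {1} else {0, 1})"
      by (auto dest!: J_cases simp: DRR DIR intro!: rev_image_eqI[OF InrI[of b]])
    then show ?thesis by (simp add: inf01_def cInf_eq_Min)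
  qed
  have inf_e01: "inf01 (e \<pi> ` X) \<in> {0..1}" for \<pi> X
    using inf01_bounds[of "e \<pi> ` X"] e01 by (simp add: image_subset_iff)
  have left01: "(\<lambda>j. inf01 (D j ` J t)) ` J s \<subseteq> {0..1}"
    using inf_e01 by (auto dest!: J_cases simp: left_Inl left_Inr)
  have right01: "(\<lambda>i. inf01 ((\<lambda>j. D j i) ` J s)) ` J t \<subseteq> {0..1}"
    using inf_e01 by (auto dest!: J_cases simp: right_Inl right_Inr)
  have missing: "inf01 (e \<pi> ` der T s a) = 1" if "a \<notin> init T s" for a \<pi> s
  proof -
    have "der T s a = {}"
      using that by (auto simp: der_def init_def)
    then show ?thesis by (simp add: inf01_def)
  qed
  have "form_dist_upto disc (Suc k) (mimic T (Suc m) s) (mimic T (Suc n) t)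
      = max (sup01 ((\<lambda>j. inf01 (D j ` J t)) ` J s)) (sup01 ((\<lambda>i. inf01 ((\<lambda>j. D j i) ` J s)) ` J t))"
    (is "_ = ?M")
    unfolding mimic form_dist_upto_eqs(5) D_def ..
  also have "\<dots> = bisim_op disc T d s t"
  proof -
    \<comment> \<open>The suprema range over different index sets (conjuncts, respectively actions
      and then derivatives), so they are compared through their upper bounds.\<close>
    have le_iff: "?M \<le> c \<longleftrightarrow> bisim_op disc T d s t \<le> c" for c
    proof -
      have "?M \<le> c
        \<longleftrightarrow> 0 \<le> c \<and> (\<forall>j\<in>J s. inf01 (D j ` J t) \<le> c) \<and> (\<forall>i\<in>J t. inf01 ((\<lambda>j. D j i) ` J s) \<le> c)"
        by (auto simp: sup01_le_iff[OF left01] sup01_le_iff[OF right01])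
      also have "\<dots> \<longleftrightarrow> 0 \<le> c \<and> (\<forall>a. (\<forall>\<pi>\<in>der T s a. inf01 (e \<pi> ` der T t a) \<le> c)
          \<and> (\<forall>\<pi>\<in>der T t a. inf01 (e \<pi> ` der T s a) \<le> c))
          \<and> (\<forall>a. (a \<in> init T s) \<noteq> (a \<in> init T t) \<longrightarrow> 1 \<le> c)"
        by (auto simp: ball_J left_Inl left_Inr right_Inl right_Inr)
      \<comment> \<open>The clause from the negated conjuncts is absorbed: an action enabled on one
        side only has a transition whose infimum ranges over the empty set and is 1.\<close>
      also have "\<dots> \<longleftrightarrow> 0 \<le> c \<and> (\<forall>a. (\<forall>\<pi>\<in>der T s a. inf01 (e \<pi> ` der T t a) \<le> c)
          \<and> (\<forall>\<pi>\<in>der T t a. inf01 (e \<pi> ` der T s a) \<le> c))"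
      proof -
        have "1 \<le> c" if "a \<in> init T s" "a \<notin> init T t" "\<forall>\<pi>\<in>der T s a. inf01 (e \<pi> ` der T t a) \<le> c"
          for a s t
          using that missing[of a t] by (auto simp: init_def der_def)
        then show ?thesis by meson
      qed
      also have "\<dots> \<longleftrightarrow> 0 \<le> c \<and> (\<forall>a. hausdorff e (der T s a) (der T t a) \<le> c)"
      proof -
        have "(\<lambda>\<pi>. inf01 (e \<pi> ` X)) ` Y \<subseteq> {0..1}" for X Y
          using inf_e01 by auto
        then show ?thesis
          unfolding hausdorff_def by (auto simp: sup01_le_iff)
      qed
      also have "\<dots> \<longleftrightarrow> bisim_op disc T d s t \<le> c"
      proof -
        have "range (\<lambda>a. hausdorff e (der T s a) (der T t a)) \<subseteq> {0..1}"
          using hausdorff_bounds[of e, OF e01] by auto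
        then show ?thesis
          unfolding bisim_op_def e_def[symmetric] by (auto simp: sup01_le_iff)
      qed
      finally show ?thesis .
    qed
    show ?thesis
      by (rule antisym) (use le_iff in blast)+
  qed
  finally show ?thesis .
qed

lemma form_dist_upto_mimic:
  assumes "0 < disc" "disc \<le> 1"
    and "k \<le> m \<or> depth T s < enat m" "k \<le> n \<or> depth T t < enat n"
  shows "form_dist_upto disc k (mimic T m s) (mimic T n t) = bisim_metric_upto disc T k s t"
  using assms(3,4)
proof (induction k arbitrary: m n s t)
  case 0
  show ?case by (simp add: bisim_metric_upto_def)
next
  case (Suc k)
  \<comment> \<open>Neither alternative admits level 0, so both formulae are conjunctions and both
    levels drop together with \<open>k\<close>.\<close>
  have "m \<noteq> 0" "n \<noteq> 0"
    using Suc.prems by (auto simp: zero_enat_def[symmetric] intro!: gr0I)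
  then obtain m' n' where [simp]: "m = Suc m'" "n = Suc n'"
    by (meson not0_implies_Suc)
  have "form_dist_upto disc k (mimic T m' u) (mimic T n' v) = bisim_metric_upto disc T k u v"
    if "\<pi> \<in> der T s a" "\<pi>' \<in> der T t a" "u \<in> set_pmf \<pi>" "v \<in> set_pmf \<pi>'" for a \<pi> \<pi>' u v
    using that Suc.prems by (intro Suc.IH) (auto intro: depth_derivative_less)
  then show ?case
    unfolding bisim_metric_upto_Suc \<open>m = Suc m'\<close> \<open>n = Suc n'\<close>
    by (intro form_dist_upto_mimic_Suc assms(1,2) unit_valued_bisim_metric_upto
        bisim_metric_upto_sym)
qed

theorem theorem6:
  fixes T :: "('s::countable, 'a::countable) transition set" and disc :: real
  assumes "pts T" and "0 < disc" and "disc \<le> 1"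
  shows "(\<forall>s t k. logical_dist_upto disc T k s t = bisim_metric_upto disc T k s t) \<and>
         (\<forall>s t. finite_process T s \<and> finite_process T t \<longrightarrow>
            logical_dist disc T s t = bisim_metric disc T s t)"
proof (intro conjI allI impI)
  fix s t k
  show "logical_dist_upto disc T k s t = bisim_metric_upto disc T k s t"
    unfolding logical_dist_upto_def by (rule form_dist_upto_mimic) (use assms in auto)
next
  fix s t assume "finite_process T s \<and> finite_process T t"
  then obtain m n where mn: "depth T s = enat m" "depth T t = enat n"
    by (auto simp: finite_process_def)
  \<comment> \<open>The level of \<open>mimic_full\<close> is the depth plus one, so the depth
    alternative holds for every \<open>k\<close>.\<close>
  have D: "form_dist_upto disc k (mimic_full T s) (mimic_full T t) = bisim_metric_upto disc T k s t"
    for k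
    unfolding mimic_full_def by (rule form_dist_upto_mimic) (use assms mn in auto)
  \<comment> \<open>Beyond both depths the sequence is constant, which gives its limit.\<close>
  have "bisim_metric_upto disc T k s t = bisim_metric disc T s t" if "max m n < k" for k
    by (rule bisim_metric_upto_eq_fixpoint) (use that mn bisim_metric_least[OF assms(2,3)] in auto)
  then have "eventually (\<lambda>k. form_dist_upto disc k (mimic_full T s) (mimic_full T t)
      = bisim_metric disc T s t) sequentially"
    unfolding D by (rule eventually_sequentiallyI[of "Suc (max m n)"]) auto
  then have "(\<lambda>k. form_dist_upto disc k (mimic_full T s) (mimic_full T t))
      \<longlonglongrightarrow> bisim_metric disc T s t"
    by (rule tendsto_eventually)
  then show "logical_dist disc T s t = bisim_metric disc T s t"
    unfolding logical_dist_def form_dist_def by (rule limI)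
qed

end
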